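(* Let $f=(f_1,\ldots,f_p)\colon\mathbb{R}^n\to\mathbb{R}^p$, $g=(g_1,\ldots,g_m)\colon\mathbb{R}^n\to\mathbb{R}^m$ and $h=(h_1,\ldots,h_r)\colon\mathbb{R}^n\to\mathbb{R}^r$ have locally Lipschitz components, and let $\mathcal{F}=\{x\in\mathbb{R}^n : g_i(x)\le 0\ (i=1,\ldots,m),\ h_j(x)=0\ (j=1,\ldots,r)\}$. If $\bar x\in\mathcal{F}$ is a local weak efficient solution of the problem of minimizing $f$ over $\mathcal{F}$ with respect to $\mathbb{R}^p_+$, then there exist sequences $\{x^k\}_{k\in\mathbb{N}}\subset\mathbb{R}^n$ and $\{(\lambda^k,\mu^k,\tau^k)\}_{k\in\mathbb{N}}\subset\mathbb{R}^p_+\times\mathbb{R}^m_+\times\mathbb{R}^r$ satisfying the AKKT condition at $\bar x$. Furthermore, these sequences can be chosen such that the following conditions hold: (E1) $\mu_i^k=b_k\max(g_i(x^k),0)\ge 0$ for all $i\in\{1,\ldots,m\}$, and $\tau_j^k=c_kh_j(x^k)\ge 0$ for all $j\in\{1,\ldots,r\}$, where $b_k,c_k>0$, for all $k\in\mathbb{N}$; (E2) for all $k\in\mathbb{N}$ and all $l\in\{1,\ldots,p\}$, $$f_l(x^k)-f_l(\bar x)+\frac12\Big[\sum_{i=1}^m\mu_i^kg_i(x^k)+\sum_{j=1}^r\tau_j^kh_j(x^k)\Big]\le 0.$$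
   Context: $\mathbb{R}^n$ carries the Euclidean inner product and norm; $\mathbb{R}^p_+$ is the nonnegative orthant of $\mathbb{R}^p$; $\mathbb{N}=\{1,2,\ldots\}$. Subdifferential. For $S\subset\mathbb{R}^n$, $x\in S$ and $\varepsilon\ge 0$, the set of $\varepsilon$-normals is $\widehat N_\varepsilon(x;S)=\{z^*\in\mathbb{R}^n : \limsup_{u\to x,\,u\in S}\frac{\langle z^*,u-x\rangle}{\|u-x\|}\le\varepsilon\}$. For $\bar x\in\mathrm{cl}\,S$, the Mordukhovich (limiting) normal cone $N(\bar x;S)$ is the set of all $z^*\in\mathbb{R}^n$ for which there are $x^k\in S$ with $x^k\to\bar x$, $\varepsilon_k\to0^+$ and $z_k^*\to z^*$ with $z^*_k\in\widehat N_{\varepsilon_k}(x^k;S)$ for all $k$. For $\varphi\colon\mathbb{R}^n\to\mathbb{R}$, the Mordukhovich (limiting) subdifferential at $\bar x$ is $\partial\varphi(\bar x)=\{x^*\in\mathbb{R}^n : (x^*,-1)\in N((\bar x,\varphi(\bar x));\mathrm{epi}\,\varphi)\}$, where $\mathrm{epi}\,\varphi=\{(x,\alpha)\in\mathbb{R}^n\times\mathbb{R} : \alpha\ge\varphi(x)\}$. Weak efficiency. $\bar x\in\mathcal{F}$ is a local weak efficient solution if there is a neighborhood $U$ of $\bar x$ such that no $x\in U\cap\mathcal{F}$ satisfies $f_l(x)<f_l(\bar x)$ for all $l=1,\ldots,p$. AKKT condition. Sequences $\{x^k\}\subset\mathbb{R}^n$ and $\{(\lambda^k,\mu^k,\tau^k)\}\subset\mathbb{R}^p_+\times\mathbb{R}^m_+\times\mathbb{R}^r$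 satisfy the approximate Karush--Kuhn--Tucker (AKKT) condition at $\bar x\in\mathcal{F}$ if: (A0) $x^k\to\bar x$; (A1) $\mathfrak{m}(x^k;\lambda^k,\mu^k,\tau^k)\to0$ as $k\to\infty$, where $\mathfrak{m}(x^k;\lambda^k,\mu^k,\tau^k)$ is the infimum of $\big\|\sum_{l=1}^p\lambda_l^k\xi_l+\sum_{i=1}^m\mu_i^k\eta_i+\sum_{j=1}^r\tau_j^k\gamma_j\big\|$ over all $\xi_l\in\partial f_l(x^k)$, $\eta_i\in\partial g_i(x^k)$, $\gamma_j\in\partial h_j(x^k)\cup\partial(-h_j)(x^k)$; (A2) $\sum_{l=1}^p\lambda_l^k=1$ for all $k$; (A3) for each $i\in\{1,\ldots,m\}$ with $g_i(\bar x)<0$, $\mu_i^k=0$ for all sufficiently large $k$.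
   Formalization: In (E1) and in the h-term of (E2), h_j(x^k) is replaced by |h_j(x^k)|, so τ_j^k = c_k|h_j(x^k)| ≥ 0; as printed the claim fails, e.g. for n=p=m=r=1, f(x)=h(x)=x, g=-1, x̄=0. *)

theory Defs
  imports "HOL-Analysis.Analysis"
begin

definition locally_lipschitz :: "('a::metric_space \<Rightarrow> real) \<Rightarrow> bool" where
  "locally_lipschitz \<phi> \<longleftrightarrow> (\<forall>x. \<exists>U L. open U \<and> x \<in> U \<and> L-lipschitz_on U \<phi>)"

(* The filter "at x within S" leaves out u = x, where the quotient is 0/0.  If x is an isolated
   point of S, the filter is trivial and the upper limit is -\<infinity>, so every z is an
   \<epsilon>-normal. *)
definition eps_normals :: "real \<Rightarrow> 'a::euclidean_space \<Rightarrow> 'a set \<Rightarrow> 'a set" where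
  "eps_normals \<epsilon> x S =
     {z. Limsup (at x within S) (\<lambda>u. ereal (inner z (u - x) / norm (u - x))) \<le> ereal \<epsilon>}"

(* Empty if x is not in the closure of S. *)
definition limiting_normal_cone :: "'a::euclidean_space \<Rightarrow> 'a set \<Rightarrow> 'a set" where
  "limiting_normal_cone x S =
     {z. \<exists>(xs :: nat \<Rightarrow> 'a) (\<epsilon> :: nat \<Rightarrow> real) (zs :: nat \<Rightarrow> 'a).
           (\<forall>k. xs k \<in> S) \<and> xs \<longlonglongrightarrow> x \<and>
           (\<forall>k. 0 \<le> \<epsilon> k) \<and> \<epsilon> \<longlonglongrightarrow> 0 \<and> zs \<longlonglongrightarrow> z \<and>
           (\<forall>k. zs k \<in> eps_normals (\<epsilon> k) (xs k) S)}"

definition limiting_subdifferential :: "('a::euclidean_space \<Rightarrow> real) \<Rightarrow> 'a \<Rightarrow> 'a set" where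
  "limiting_subdifferential \<phi> x =
     {z. (z, - 1) \<in> limiting_normal_cone (x, \<phi> x) (epigraph UNIV \<phi>)}"

definition feasible_set :: "('a \<Rightarrow> real ^ 'm) \<Rightarrow> ('a \<Rightarrow> real ^ 'r) \<Rightarrow> 'a set" where
  "feasible_set g h = {x. (\<forall>i. g x $ i \<le> 0) \<and> (\<forall>j. h x $ j = 0)}"

definition local_weak_efficient ::
    "('a::topological_space \<Rightarrow> real ^ 'p) \<Rightarrow> 'a set \<Rightarrow> 'a \<Rightarrow> bool" where
  "local_weak_efficient f F x0 \<longleftrightarrow>
     x0 \<in> F \<and> (\<exists>U. open U \<and> x0 \<in> U \<and> \<not> (\<exists>x \<in> U \<inter> F. \<forall>l. f x $ l < f x0 $ l))"

(* The infimum is taken in the extended reals, where the infimum of the empty set is \<infinity>.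
   The sign of an equality constraint is carried by \<gamma>: a penalty term c/2 * (h_j)^2 contributes
   c * |h_j| * \<gamma>_j, with \<gamma>_j a subgradient of h_j where h_j > 0 and of -h_j where h_j < 0. *)
definition stationarity_measure ::
    "('a::euclidean_space \<Rightarrow> real ^ 'p) \<Rightarrow> ('a \<Rightarrow> real ^ 'm) \<Rightarrow> ('a \<Rightarrow> real ^ 'r) \<Rightarrow>
     'a \<Rightarrow> real ^ 'p \<Rightarrow> real ^ 'm \<Rightarrow> real ^ 'r \<Rightarrow> ereal" where
  "stationarity_measure f g h x lam mu tau =
     Inf {ereal (norm ((\<Sum>l\<in>UNIV. lam $ l *\<^sub>R \<xi> l) + (\<Sum>i\<in>UNIV. mu $ i *\<^sub>R \<eta> i)
                        + (\<Sum>j\<in>UNIV. tau $ j *\<^sub>R \<gamma> j))) | \<xi> \<eta> \<gamma>.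
            (\<forall>l. \<xi> l \<in> limiting_subdifferential (\<lambda>y. f y $ l) x) \<and>
            (\<forall>i. \<eta> i \<in> limiting_subdifferential (\<lambda>y. g y $ i) x) \<and>
            (\<forall>j. \<gamma> j \<in> limiting_subdifferential (\<lambda>y. h y $ j) x
                     \<union> limiting_subdifferential (\<lambda>y. - h y $ j) x)}"

definition AKKT ::
    "('a::euclidean_space \<Rightarrow> real ^ 'p) \<Rightarrow> ('a \<Rightarrow> real ^ 'm) \<Rightarrow> ('a \<Rightarrow> real ^ 'r) \<Rightarrow> 'a \<Rightarrow>
     (nat \<Rightarrow> 'a) \<Rightarrow> (nat \<Rightarrow> real ^ 'p) \<Rightarrow> (nat \<Rightarrow> real ^ 'm) \<Rightarrow> (nat \<Rightarrow> real ^ 'r) \<Rightarrow> bool" where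
  "AKKT f g h x0 x lam mu tau \<longleftrightarrow>
     x0 \<in> feasible_set g h \<and>
     (\<forall>k l. 0 \<le> lam k $ l) \<and> (\<forall>k i. 0 \<le> mu k $ i) \<and>
     x \<longlonglongrightarrow> x0 \<and>
     (\<lambda>k. stationarity_measure f g h (x k) (lam k) (mu k) (tau k)) \<longlonglongrightarrow> 0 \<and>
     (\<forall>k. (\<Sum>l\<in>UNIV. lam k $ l) = 1) \<and>
     (\<forall>i. g x0 $ i < 0 \<longrightarrow> (\<forall>\<^sub>F k in sequentially. mu k $ i = 0))"

end

theory Submission
  imports Defs
begin

text \<open>Let \<open>x k\<close> minimize the penalty function
  \<open>max l (f l x - f l x0) + c/2 (\<Sum> max (g i x) 0^2 + \<Sum> (h j x)^2) + 1/2 |x - x0|^2\<close> with \<open>c = c k\<close>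
  over a small ball around \<open>x0\<close>. Its value at \<open>x0\<close> is \<open>0\<close>, which gives (E2), and weak efficiency
  forces \<open>x k\<close> to converge to \<open>x0\<close> along a subsequence. Instead of the sum, chain and maximum rules of
  the limiting calculus, the exact multiplier rule at \<open>x k\<close> is obtained by decoupling: every function
  gets its own copy of the variable, tied to \<open>x\<close> by a quadratic penalty of weight \<open>t\<close>. At a
  minimizer of the decoupled problem the optimality condition in each copy is a Frechet subgradient
  inequality, and the condition in \<open>x\<close> says that the weighted subgradients balance. The
  subgradients are bounded by the Lipschitz constants, so they converge to limiting subgradients
  at \<open>x k\<close> along a sequence \<open>t --> infinity\<close>. The square of \<open>h j\<close> is split into
  \<open>max (h j) 0^2 + max (- h j) 0^2\<close>; at most one of the two terms has a nonzero multiplier.\<close>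

section \<open>Frechet and limiting subgradients\<close>

text \<open>The division-free form allows \<open>nhds\<close> instead of the punctured filter: at
  \<open>u = x\<close> the inequality is an equality.\<close>

definition frechet_subdifferential :: "('a::euclidean_space \<Rightarrow> real) \<Rightarrow> 'a \<Rightarrow> 'a set" where
  "frechet_subdifferential \<phi> x =
     {z. \<forall>e>0. \<forall>\<^sub>F u in nhds x. \<phi> x + inner z (u - x) - e * norm (u - x) \<le> \<phi> u}"

text \<open>A point \<open>(u, a)\<close> of the epigraph has \<open>a >= \<phi> u\<close>, so its
  increment paired with \<open>(z, - 1)\<close> is at most
  \<open>inner z (u - x) - (\<phi> u - \<phi> x)\<close>, hence at most
  \<open>e * norm (u - x)\<close> near \<open>x\<close>, for every \<open>e > 0\<close>.\<close>

lemma frechet_subdifferential_eps_normal: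
  assumes z: "z \<in> frechet_subdifferential \<phi> x"
  shows "(z, - 1) \<in> eps_normals 0 (x, \<phi> x) (epigraph UNIV \<phi>)"
proof -
  let ?F = "at (x, \<phi> x) within epigraph UNIV \<phi>"
  let ?q = "\<lambda>v. inner (z, - 1) (v - (x, \<phi> x)) / norm (v - (x, \<phi> x))"
  have le: "\<forall>\<^sub>F v in ?F. ?q v \<le> e" if e: "e > 0" for e
  proof -
    have "\<forall>\<^sub>F u in nhds x. \<phi> x + inner z (u - x) - e * norm (u - x) \<le> \<phi> u"
      using z e by (auto simp: frechet_subdifferential_def)
    moreover have "filterlim fst (nhds x) ?F"
      by (rule tendsto_eq_intros tendsto_ident_at | simp)+
    ultimately have "\<forall>\<^sub>F v in ?F. \<phi> x + inner z (fst v - x) - e * norm (fst v - x) \<le> \<phi> (fst v)"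
      by (rule eventually_compose_filterlim)
    moreover have "\<forall>\<^sub>F v in ?F. v \<in> epigraph UNIV \<phi>"
      by (simp add: eventually_at_filter)
    ultimately show ?thesis
    proof eventually_elim
      case (elim v)
      have "inner (z, - 1) (v - (x, \<phi> x)) \<le> e * norm (fst v - x)"
        using elim by (cases v) (auto simp: epigraph_def)
      also have "\<dots> \<le> e * norm (v - (x, \<phi> x))"
        using e by (cases v) (auto intro!: mult_left_mono norm_fst_le)
      finally show ?case
        using e by (cases "v = (x, \<phi> x)") (auto simp: divide_le_eq)
    qed
  qed
  have "Limsup ?F (\<lambda>v. ereal (?q v)) \<le> ereal 0"
    unfolding Limsup_le_iff
  proof (intro allI impI)
    fix c assume "ereal 0 < c"
    then obtain e where e: "0 < ereal e" "ereal e < c"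
      using ereal_dense2[of "ereal 0" c] by (auto simp: zero_ereal_def)
    then show "\<forall>\<^sub>F v in ?F. ereal (?q v) < c"
      by (intro eventually_mono[OF le[of e]])
         (auto simp: zero_ereal_def elim: order.strict_trans1[rotated])
  qed
  then show ?thesis
    by (simp add: eps_normals_def)
qed

text \<open>Continuity turns convergence of the base points into convergence on the graph; the
  tolerances of the normals can then all be \<open>0\<close>.\<close>

lemma limiting_subdifferentialI:
  assumes "ys \<longlonglongrightarrow> x" "zs \<longlonglongrightarrow> z" "isCont \<phi> x"
    and fr: "\<And>k. zs k \<in> frechet_subdifferential \<phi> (ys k)"
  shows "z \<in> limiting_subdifferential \<phi> x"
proof -
  have 1: "(\<lambda>k. (ys k, \<phi> (ys k))) \<longlonglongrightarrow> (x, \<phi> x)"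
    using assms isCont_tendsto_compose by (intro tendsto_Pair) blast+
  have 2: "(\<lambda>k. (zs k, - 1)) \<longlonglongrightarrow> (z, - 1 :: real)"
    using assms by (intro tendsto_Pair) auto
  show ?thesis
    unfolding limiting_subdifferential_def limiting_normal_cone_def mem_Collect_eq
    by (intro exI[of _ "\<lambda>k. (ys k, \<phi> (ys k))"] exI[of _ "\<lambda>k. 0"] exI[of _ "\<lambda>k. (zs k, - 1)"] conjI)
       (use 1 2 frechet_subdifferential_eps_normal[OF fr] in \<open>auto simp: mem_epigraph\<close>)
qed

section \<open>Locally Lipschitz functions and bounds on their subgradients\<close>

lemma locally_lipschitzE:
  assumes "locally_lipschitz \<phi>"
  obtains U L where "open U" "x \<in> U" "L > 0" "L-lipschitz_on U \<phi>"
proof -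
  obtain U L where "open U" "x \<in> U" "L-lipschitz_on U \<phi>"
    using assms unfolding locally_lipschitz_def by blast
  \<comment> \<open>Enlarging the constant makes it positive, so that it can be divided by
    later.\<close>
  moreover from this(3) have "(max L 1)-lipschitz_on U \<phi>"
    by (rule lipschitz_on_le) auto
  ultimately show ?thesis
    by (intro that[of U "max L 1"]) auto
qed

lemma locally_lipschitz_isCont:
  assumes "locally_lipschitz \<phi>"
  shows "isCont \<phi> x"
proof -
  obtain U L where "open U" "x \<in> U" "L > 0" "L-lipschitz_on U \<phi>"
    using locally_lipschitzE[OF assms] .
  then show ?thesis
    using lipschitz_on_continuous_on continuous_on_eq_continuous_at by blast
qed

lemma locally_lipschitz_continuous_on:
  "locally_lipschitz \<phi> \<Longrightarrow> continuous_on S \<phi>"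
  by (simp add: continuous_at_imp_continuous_on locally_lipschitz_isCont)

lemma locally_lipschitz_uminus:
  "locally_lipschitz \<phi> \<Longrightarrow> locally_lipschitz (\<lambda>x. - \<phi> x)"
  unfolding locally_lipschitz_def by (metis lipschitz_on_minus)

text \<open>Testing the subgradient inequality at \<open>y + s z\<close> with small
  \<open>s > 0\<close> bounds \<open>s * norm z * norm z\<close> by
  \<open>s * (L + e) * norm z\<close>.\<close>

lemma frechet_subdifferential_norm_le:
  assumes U: "open U" "y \<in> U" "L-lipschitz_on U \<phi>" and z: "z \<in> frechet_subdifferential \<phi> y"
  shows "norm z \<le> L"
proof (rule field_le_epsilon)
  fix e :: real assume e: "e > 0"
  have "\<forall>\<^sub>F u in nhds y. \<phi> y + inner z (u - y) - e * norm (u - y) \<le> \<phi> u"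
    using z e by (auto simp: frechet_subdifferential_def)
  moreover have "\<forall>\<^sub>F u in nhds y. u \<in> U"
    using U by (simp add: eventually_nhds_in_open)
  ultimately have ev: "\<forall>\<^sub>F u in nhds y. \<phi> y + inner z (u - y) - e * norm (u - y) \<le> \<phi> u \<and> u \<in> U"
    by (rule eventually_conj)
  have "((\<lambda>s. y + s *\<^sub>R z) \<longlongrightarrow> y + 0 *\<^sub>R z) (at_right (0::real))"
    by (intro tendsto_intros)
  then have "filterlim (\<lambda>s. y + s *\<^sub>R z) (nhds y) (at_right (0::real))"
    by simp
  from eventually_compose_filterlim[OF ev this]
  have "\<forall>\<^sub>F s in at_right (0::real). 0 < s \<and> \<phi> y + inner z (s *\<^sub>R z) - e * norm (s *\<^sub>R z) \<le> \<phi> (y + s *\<^sub>R z)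
      \<and> y + s *\<^sub>R z \<in> U"
    using eventually_at_right_less[of 0] by eventually_elim auto
  then obtain s where s: "s > 0" "\<phi> y + inner z (s *\<^sub>R z) - e * norm (s *\<^sub>R z) \<le> \<phi> (y + s *\<^sub>R z)"
     "y + s *\<^sub>R z \<in> U"
    using eventually_happens'[OF trivial_limit_at_right_real] by blast
  have "\<bar>\<phi> (y + s *\<^sub>R z) - \<phi> y\<bar> \<le> L * norm (s *\<^sub>R z)"
    using lipschitz_onD[OF U(3) s(3) U(2)] by (simp add: dist_norm)
  then have "s * (norm z * norm z) \<le> s * ((L + e) * norm z)"
    using s by (simp add: algebra_simps power2_norm_eq_inner[symmetric] power2_eq_square)
  then have "norm z * norm z \<le> (L + e) * norm z"
    using s(1) by simp
  then show "norm z \<le> L + e"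
    using e lipschitz_on_nonneg[OF U(3)] by (cases "z = 0") auto
qed

text \<open>The increment of the smooth outer function is at most the first-order term
  \<open>w (\<phi> u - \<phi> y)\<close> up to \<open>o(|u - y|)\<close>, so dividing by \<open>w\<close> turns minimality into a subgradient
  inequality for \<open>\<phi>\<close>.\<close>
lemma frechet_subdifferential_of_penalized_min:
  assumes psi: "(\<psi> has_real_derivative w) (at (\<phi> y))" and w: "w > 0" and t: "t > 0"
    and lip: "locally_lipschitz \<phi>"
    and min: "\<forall>\<^sub>F u in nhds y.
      \<psi> (\<phi> y) + t / 2 * (norm (y - x))\<^sup>2 \<le> \<psi> (\<phi> u) + t / 2 * (norm (u - x))\<^sup>2"
  shows "(t / w) *\<^sub>R (x - y) \<in> frechet_subdifferential \<phi> y"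
  unfolding frechet_subdifferential_def mem_Collect_eq
proof (intro allI impI)
  fix e :: real assume e: "e > 0"
  obtain U L where U: "open U" "y \<in> U" "L > 0" "L-lipschitz_on U \<phi>"
    using locally_lipschitzE[OF lip] .
  \<comment> \<open>The error budget \<open>e * w * d\<close> is split in halves. Increments of
    \<open>\<phi>\<close> are at most \<open>L * d\<close>, so this \<open>e1\<close> spends one
    half on the linearization of \<open>\<psi>\<close>; the radius in \<open>E3\<close> keeps the
    quadratic remainder within the other half.\<close>
  define e1 where "e1 = e * w / (2 * L)"
  have e1: "e1 > 0" using e w U by (simp add: e1_def)
  have "\<forall>\<^sub>F s in nhds (\<phi> y). \<bar>\<psi> s - \<psi> (\<phi> y) - w * (s - \<phi> y)\<bar> \<le> e1 * \<bar>s - \<phi> y\<bar>"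
  proof -
    obtain d where "d > 0" "\<And>s. \<bar>s - \<phi> y\<bar> < d \<Longrightarrow>
        \<bar>\<psi> s - \<psi> (\<phi> y) - w * (s - \<phi> y)\<bar> \<le> e1 * \<bar>s - \<phi> y\<bar>"
      using psi e1 unfolding has_field_derivative_def has_derivative_at_alt real_norm_def by blast
    then show ?thesis
      by (auto simp: eventually_nhds_metric dist_real_def)
  qed
  from eventually_compose_filterlim[OF this, of \<phi> "nhds y"] 
  have E1: "\<forall>\<^sub>F u in nhds y. \<bar>\<psi> (\<phi> u) - \<psi> (\<phi> y) - w * (\<phi> u - \<phi> y)\<bar> \<le> e1 * \<bar>\<phi> u - \<phi> y\<bar>"
    using locally_lipschitz_isCont[OF lip, of y] by (simp add: continuous_at tendsto_at_iff_tendsto_nhds)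
  have E2: "\<forall>\<^sub>F u in nhds y. u \<in> U"
    using U by (simp add: eventually_nhds_in_open)
  have E3: "\<forall>\<^sub>F u in nhds y. dist u y < e * w / t"
    unfolding eventually_nhds_metric using e w t by (intro exI[of _ "e * w / t"]) auto
  show "\<forall>\<^sub>F u in nhds y. \<phi> y + inner ((t / w) *\<^sub>R (x - y)) (u - y) - e * norm (u - y) \<le> \<phi> u"
    using min E1 E2 E3
  proof eventually_elim
    case (elim u)
    define d where "d = norm (u - y)"
    have d: "d \<ge> 0" by (simp add: d_def)
    have lu: "\<bar>\<phi> u - \<phi> y\<bar> \<le> L * d"
      using lipschitz_onD[OF U(4) elim(3) U(2)] by (simp add: dist_norm d_def)
    \<comment> \<open>The cross term of this expansion supplies the subgradient; the square of
      \<open>d\<close> is of second order.\<close>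
    have sq: "(norm (u - x))\<^sup>2 = (norm (y - x))\<^sup>2 + d\<^sup>2 - 2 * inner (x - y) (u - y)"
      unfolding d_def power2_norm_eq_inner by (simp add: algebra_simps inner_commute)
    have "e1 * \<bar>\<phi> u - \<phi> y\<bar> \<le> e * w / 2 * d"
      using mult_left_mono[OF lu, of e1] e1 U by (simp add: e1_def)
    moreover have "t / 2 * d\<^sup>2 \<le> e * w / 2 * d"
    proof -
      have "d \<le> e * w / t" using elim(4) by (simp add: d_def dist_norm)
      then have "t * d \<le> e * w" using t by (simp add: field_simps)
      from mult_right_mono[OF this d] show ?thesis by (simp add: power2_eq_square)
    qed
    ultimately have "w * (\<phi> u - \<phi> y) \<ge> t * inner (x - y) (u - y) - e * w * d"
      using elim(1,2) unfolding sq by (simp add: algebra_simps abs_le_iff)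
    then have "w * (\<phi> y + inner ((t / w) *\<^sub>R (x - y)) (u - y) - e * d) \<le> w * \<phi> u"
      using w by (simp add: algebra_simps)
    then show ?case
      using w by (simp add: d_def)
  qed
qed

section \<open>The decoupled problem\<close>

text \<open>Isolates the one summand that varies when a single copy is moved and the others are
  frozen.\<close>

lemma sum_upd_vec:
  fixes y :: "'a ^ 'p" and H :: "'p \<Rightarrow> 'a \<Rightarrow> real"
  shows "(\<Sum>k\<in>UNIV. H k ((\<chi> k. if k = l then u else y $ k) $ k)) =
         H l u + (\<Sum>k\<in>UNIV - {l}. H k (y $ k))"
  by (subst sum.remove[of _ l]) (auto intro!: sum.cong)

text \<open>The maximum of the \<open>F l\<close> is smoothed by log-sum-exp, and the term \<open>G i / t\<close> gives every \<open>G i\<close>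
  a positive weight even where its penalty vanishes, so that each copy \<open>y $ l\<close>, \<open>z $ i\<close> yields a
  subgradient after division by its weight. The term \<open>(norm (x - xb))\<^sup>2 / 2\<close> makes \<open>xb\<close> a strict
  minimizer in the limit.\<close>
definition decoupled ::
    "('p \<Rightarrow> 'a::euclidean_space \<Rightarrow> real) \<Rightarrow> ('q \<Rightarrow> 'a \<Rightarrow> real) \<Rightarrow> real \<Rightarrow> 'a \<Rightarrow> 'a \<Rightarrow> real \<Rightarrow>
     'a \<Rightarrow> 'a ^ 'p \<Rightarrow> 'a ^ 'q \<Rightarrow> real" where
  "decoupled F G c x0 xb t x y z =
     ln (\<Sum>l\<in>UNIV. exp (t * F l (y $ l))) / t
     + (\<Sum>i\<in>UNIV. c / 2 * (max (G i (z $ i)) 0)\<^sup>2 + G i (z $ i) / t)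
     + (norm (x - x0))\<^sup>2 / 2 + (norm (x - xb))\<^sup>2 / 2
     + t / 2 * ((\<Sum>l\<in>UNIV. (norm (y $ l - x))\<^sup>2) + (\<Sum>i\<in>UNIV. (norm (z $ i - x))\<^sup>2))"

text \<open>Squaring removes the kink: at \<open>0\<close> the difference quotient is bounded by
  \<open>\<bar>s\<bar>\<close>. The penalty is therefore a smooth outer function of each
  constraint.\<close>

lemma has_real_derivative_max_0_squared:
  "((\<lambda>s. (max s 0)\<^sup>2) has_real_derivative 2 * max a 0) (at a)"
proof (cases a "0 :: real" rule: linorder_cases)
  case less
  show ?thesis
    by (rule has_field_derivative_transform_within_open[where f="\<lambda>s. 0" and S="{..<0}"])
       (use less in auto)
next
  case greater
  show ?thesis
    by (rule has_field_derivative_transform_within_open[where f="\<lambda>s. s\<^sup>2" and S="{0<..}"])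
       (use greater in \<open>auto intro!: derivative_eq_intros\<close>)
next
  case equal
  have "norm ((max s 0)\<^sup>2 / s) \<le> \<bar>s\<bar>" for s :: real
    by (cases "s \<ge> 0") (auto simp: power2_eq_square)
  moreover have "((\<lambda>s. \<bar>s\<bar>) \<longlongrightarrow> 0) (at (0::real))"
    by (auto intro!: tendsto_eq_intros)
  ultimately have "((\<lambda>s. (max s 0)\<^sup>2 / s) \<longlongrightarrow> 0) (at (0::real))"
    by (rule Lim_null_comparison[OF always_eventually[OF allI]])
  then show ?thesis
    using equal by (simp add: DERIV_def)
qed

lemma has_derivative_norm_diff_squared:
  fixes a x :: "'a::real_inner"
  shows "((\<lambda>u. (norm (u - a))\<^sup>2) has_derivative (\<lambda>v. 2 * inner (x - a) v)) (at x)"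
    and "((\<lambda>u. (norm (a - u))\<^sup>2) has_derivative (\<lambda>v. 2 * inner (x - a) v)) (at x)"
proof -
  show *: "((\<lambda>u. (norm (u - a))\<^sup>2) has_derivative (\<lambda>v. 2 * inner (x - a) v)) (at x)"
    unfolding power2_norm_eq_inner
    by (auto intro!: derivative_eq_intros simp: inner_commute)
  then show "((\<lambda>u. (norm (a - u))\<^sup>2) has_derivative (\<lambda>v. 2 * inner (x - a) v)) (at x)"
    by (simp add: norm_minus_commute)
qed

text \<open>Minimality is used one block at a time. In \<open>y $ l\<close> the outer function is a
  log-sum-exp whose derivative is the softmax weight \<open>lam $ l\<close>; these weights are
  positive and sum to \<open>1\<close>. In \<open>z $ i\<close> the derivative is
  \<open>w i\<close>. Multiplied by its weight, each subgradient becomes \<open>t\<close> times the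
  gap between \<open>x\<close> and the copy, and stationarity in \<open>x\<close> balances these
  gaps.\<close>

lemma decoupled_stationary:
  fixes F :: "'p::finite \<Rightarrow> 'a::euclidean_space \<Rightarrow> real" and G :: "'q::finite \<Rightarrow> 'a \<Rightarrow> real"
  assumes F: "\<And>l. locally_lipschitz (F l)" and G: "\<And>i. locally_lipschitz (G i)"
    and t: "t > 0" and c: "c \<ge> 0"
    and min: "\<forall>\<^sub>F v in nhds (x, y, z). decoupled F G c x0 xb t x y z \<le>
                decoupled F G c x0 xb t (fst v) (fst (snd v)) (snd (snd v))"
  obtains lam :: "real ^ 'p" and \<xi> :: "'a ^ 'p" and \<eta> :: "'a ^ 'q" where
    "\<And>l. 0 \<le> lam $ l" "(\<Sum>l\<in>UNIV. lam $ l) = 1"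
    "\<And>l. \<xi> $ l \<in> frechet_subdifferential (F l) (y $ l)"
    "\<And>i. \<eta> $ i \<in> frechet_subdifferential (G i) (z $ i)"
    "(\<Sum>l\<in>UNIV. lam $ l *\<^sub>R \<xi> $ l)
     + (\<Sum>i\<in>UNIV. (c * max (G i (z $ i)) 0 + 1 / t) *\<^sub>R \<eta> $ i) + (x - x0) + (x - xb) = 0"
proof -
  let ?J = "decoupled F G c x0 xb t"
  define E where "E = (\<Sum>l\<in>UNIV. exp (t * F l (y $ l)))"
  define lam :: "real ^ 'p" where "lam = (\<chi> l. exp (t * F l (y $ l)) / E)"
  define w where "w = (\<lambda>i. c * max (G i (z $ i)) 0 + 1 / t)"
  have Epos: "E > 0" unfolding E_def by (intro sum_pos) auto
  have lampos: "lam $ l > 0" for l using Epos by (simp add: lam_def)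
  have lamsum: "(\<Sum>l\<in>UNIV. lam $ l) = 1"
    using Epos by (simp add: lam_def E_def sum_divide_distrib[symmetric])
  have wpos: "w i > 0" for i using c t by (simp add: w_def add_nonneg_pos)

  have xi: "(t / lam $ l) *\<^sub>R (x - y $ l) \<in> frechet_subdifferential (F l) (y $ l)" for l
  proof (rule frechet_subdifferential_of_penalized_min[OF _ lampos t F])
    \<comment> \<open>With the other copies frozen, their exponentials form a constant, and the
      log-sum-exp depends on one real variable.\<close>
    define R where "R = (\<Sum>k\<in>UNIV - {l}. exp (t * F k (y $ k)))"
    have R: "R \<ge> 0" unfolding R_def by (intro sum_nonneg) auto
    have ER: "E = exp (t * F l (y $ l)) + R"
      unfolding E_def R_def by (subst sum.remove[of _ l]) auto
    let ?psi = "\<lambda>s. ln (exp (t * s) + R) / t"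
    show "(?psi has_real_derivative lam $ l) (at (F l (y $ l)))"
      using t R by (auto intro!: derivative_eq_intros simp: lam_def ER add_pos_nonneg)
    let ?u = "\<lambda>u. (\<chi> k. if k = l then u else y $ k)"
    have "((\<lambda>u. ?u u $ k) \<longlongrightarrow> ?u (y $ l) $ k) (nhds (y $ l))" for k
      by (cases "k = l") (auto simp: filterlim_ident)
    then have "((\<lambda>u. ?u u) \<longlongrightarrow> ?u (y $ l)) (nhds (y $ l))"
      by (intro vec_tendstoI)
    moreover have "?u (y $ l) = y"
      by (simp add: vec_eq_iff)
    ultimately have lim: "((\<lambda>u. (x, ?u u, z)) \<longlongrightarrow> (x, y, z)) (nhds (y $ l))"
      by (auto intro!: tendsto_intros)
    have diff: "?J x (?u u) z - ?J x y z = (?psi (F l u) + t / 2 * (norm (u - x))\<^sup>2)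
        - (?psi (F l (y $ l)) + t / 2 * (norm (y $ l - x))\<^sup>2)" for u
    proof -
      have 1: "(\<Sum>k\<in>UNIV. exp (t * F k (?u u $ k))) = exp (t * F l u) + R"
        using sum_upd_vec[of "\<lambda>k v. exp (t * F k v)" l u y] by (simp add: R_def)
      have 2: "(\<Sum>k\<in>UNIV. (norm (?u u $ k - x))\<^sup>2) =
          (norm (u - x))\<^sup>2 + (\<Sum>k\<in>UNIV - {l}. (norm (y $ k - x))\<^sup>2)"
        using sum_upd_vec[of "\<lambda>k v. (norm (v - x))\<^sup>2" l u y] by simp
      have 3: "(\<Sum>k\<in>UNIV. (norm (y $ k - x))\<^sup>2) =
          (norm (y $ l - x))\<^sup>2 + (\<Sum>k\<in>UNIV - {l}. (norm (y $ k - x))\<^sup>2)"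
        by (subst sum.remove[of _ l]) auto
      show ?thesis
        unfolding decoupled_def 1 2 3 E_def[symmetric] ER by (simp add: algebra_simps)
    qed
    show "\<forall>\<^sub>F u in nhds (y $ l). ?psi (F l (y $ l)) + t / 2 * (norm (y $ l - x))\<^sup>2
        \<le> ?psi (F l u) + t / 2 * (norm (u - x))\<^sup>2"
      using eventually_compose_filterlim[OF min lim]
    proof eventually_elim
      case (elim u)
      then have "?J x y z \<le> ?J x (?u u) z" by simp
      then show ?case using diff[of u] by linarith
    qed
  qed

  have eta: "(t / w i) *\<^sub>R (x - z $ i) \<in> frechet_subdifferential (G i) (z $ i)" for i
  proof (rule frechet_subdifferential_of_penalized_min[OF _ wpos t G])
    let ?psi = "\<lambda>s. c / 2 * (max s 0)\<^sup>2 + s / t"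
    show "(?psi has_real_derivative w i) (at (G i (z $ i)))"
      by (rule DERIV_cong[OF DERIV_add[OF DERIV_cmult[OF has_real_derivative_max_0_squared]
            DERIV_cdivide[OF DERIV_ident]]]) (simp add: w_def)
    let ?u = "\<lambda>u. (\<chi> k. if k = i then u else z $ k)"
    have "((\<lambda>u. ?u u $ k) \<longlongrightarrow> ?u (z $ i) $ k) (nhds (z $ i))" for k
      by (cases "k = i") (auto simp: filterlim_ident)
    then have "((\<lambda>u. ?u u) \<longlongrightarrow> ?u (z $ i)) (nhds (z $ i))"
      by (intro vec_tendstoI)
    moreover have "?u (z $ i) = z"
      by (simp add: vec_eq_iff)
    ultimately have lim: "((\<lambda>u. (x, y, ?u u)) \<longlongrightarrow> (x, y, z)) (nhds (z $ i))"
      by (auto intro!: tendsto_intros)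
    have diff: "?J x y (?u u) - ?J x y z = (?psi (G i u) + t / 2 * (norm (u - x))\<^sup>2)
        - (?psi (G i (z $ i)) + t / 2 * (norm (z $ i - x))\<^sup>2)" for u
    proof -
      have 1: "(\<Sum>k\<in>UNIV. c / 2 * (max (G k (?u u $ k)) 0)\<^sup>2 + G k (?u u $ k) / t) =
          ?psi (G i u) + (\<Sum>k\<in>UNIV - {i}. c / 2 * (max (G k (z $ k)) 0)\<^sup>2 + G k (z $ k) / t)"
        using sum_upd_vec[of "\<lambda>k v. c / 2 * (max (G k v) 0)\<^sup>2 + G k v / t" i u z] by simp
      have 2: "(\<Sum>k\<in>UNIV. (norm (?u u $ k - x))\<^sup>2) =
          (norm (u - x))\<^sup>2 + (\<Sum>k\<in>UNIV - {i}. (norm (z $ k - x))\<^sup>2)"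
        using sum_upd_vec[of "\<lambda>k v. (norm (v - x))\<^sup>2" i u z] by simp
      have 3: "(\<Sum>k\<in>UNIV. (norm (z $ k - x))\<^sup>2) =
          (norm (z $ i - x))\<^sup>2 + (\<Sum>k\<in>UNIV - {i}. (norm (z $ k - x))\<^sup>2)"
        by (subst sum.remove[of _ i]) auto
      have 4: "(\<Sum>k\<in>UNIV. c / 2 * (max (G k (z $ k)) 0)\<^sup>2 + G k (z $ k) / t) =
          ?psi (G i (z $ i)) + (\<Sum>k\<in>UNIV - {i}. c / 2 * (max (G k (z $ k)) 0)\<^sup>2 + G k (z $ k) / t)"
        by (subst sum.remove[of _ i]) auto
      show ?thesis
        unfolding decoupled_def 1 2 3 4 by (simp add: algebra_simps)
    qed
    show "\<forall>\<^sub>F u in nhds (z $ i). ?psi (G i (z $ i)) + t / 2 * (norm (z $ i - x))\<^sup>2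
        \<le> ?psi (G i u) + t / 2 * (norm (u - x))\<^sup>2"
      using eventually_compose_filterlim[OF min lim]
    proof eventually_elim
      case (elim u)
      then have "?J x y z \<le> ?J x y (?u u)" by simp
      then show ?case using diff[of u] by linarith
    qed
  qed

  \<comment> \<open>The gradient of the objective in the shared variable \<open>x\<close>.\<close>
  define g where "g = (x - x0) + (x - xb) + t *\<^sub>R ((\<Sum>l\<in>UNIV. x - y $ l) + (\<Sum>i\<in>UNIV. x - z $ i))"
  have g0: "g = 0"
  proof -
    have lim: "((\<lambda>u. (u, y, z)) \<longlongrightarrow> (x, y, z)) (nhds x)"
      by (auto intro!: tendsto_intros simp: filterlim_ident)
    have "\<forall>\<^sub>F u in nhds x. ?J x y z \<le> ?J u y z"
      using eventually_compose_filterlim[OF min lim] by simp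
    then obtain S where S: "open S" "x \<in> S" "\<And>u. u \<in> S \<Longrightarrow> ?J x y z \<le> ?J u y z"
      by (auto simp: eventually_nhds)
    define C0 where "C0 = ?J x y z - (1 / 2 * (norm (x - x0))\<^sup>2 + 1 / 2 * (norm (x - xb))\<^sup>2
      + t / 2 * ((\<Sum>l\<in>UNIV. (norm (y $ l - x))\<^sup>2) + (\<Sum>i\<in>UNIV. (norm (z $ i - x))\<^sup>2)))"
    have J: "?J u y z = C0 + (1 / 2 * (norm (u - x0))\<^sup>2 + 1 / 2 * (norm (u - xb))\<^sup>2
      + t / 2 * ((\<Sum>l\<in>UNIV. (norm (y $ l - u))\<^sup>2) + (\<Sum>i\<in>UNIV. (norm (z $ i - u))\<^sup>2)))" for u
      unfolding C0_def decoupled_def by simp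
    have gv: "0 + (1 / 2 * (2 * inner (x - x0) v) + 1 / 2 * (2 * inner (x - xb) v)
        + t / 2 * ((\<Sum>l\<in>UNIV. 2 * inner (x - y $ l) v) + (\<Sum>i\<in>UNIV. 2 * inner (x - z $ i) v)))
        = inner g v" for v
      unfolding g_def inner_add_left inner_scaleR_left inner_sum_left sum_distrib_left[symmetric]
      by (simp only: distrib_left)
    have "((\<lambda>u. ?J u y z) has_derivative (\<lambda>v. inner g v)) (at x)"
      unfolding J gv[symmetric]
      by (intro has_derivative_add has_derivative_const has_derivative_mult_right
            has_derivative_sum has_derivative_norm_diff_squared)
    from differential_zero_maxmin[OF S(2,1) this] S(3) have "inner g g = 0"
      by (metis (no_types, lifting))
    then show ?thesis by simp
  qed

  show ?thesis
  proof (rule that[of lam "\<chi> l. (t / lam $ l) *\<^sub>R (x - y $ l)" "\<chi> i. (t / w i) *\<^sub>R (x - z $ i)"])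
    have nz: "lam $ l \<noteq> 0" "w i \<noteq> 0" for l i using lampos[of l] wpos[of i] by auto
    have weq: "c * max (G i (z $ i)) 0 + 1 / t = w i" for i by (simp add: w_def)
    have 1: "(\<Sum>l\<in>UNIV. lam $ l *\<^sub>R (\<chi> l. (t / lam $ l) *\<^sub>R (x - y $ l)) $ l) = t *\<^sub>R (\<Sum>l\<in>UNIV. x - y $ l)"
      using nz by (simp add: scaleR_sum_right)
    have 2: "(\<Sum>i\<in>UNIV. (c * max (G i (z $ i)) 0 + 1 / t) *\<^sub>R (\<chi> i. (t / w i) *\<^sub>R (x - z $ i)) $ i)
        = t *\<^sub>R (\<Sum>i\<in>UNIV. x - z $ i)"
      unfolding weq using nz by (simp add: scaleR_sum_right)
    show "(\<Sum>l\<in>UNIV. lam $ l *\<^sub>R (\<chi> l. (t / lam $ l) *\<^sub>R (x - y $ l)) $ l) +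
      (\<Sum>i\<in>UNIV. (c * max (G i (z $ i)) 0 + 1 / t) *\<^sub>R (\<chi> i. (t / w i) *\<^sub>R (x - z $ i)) $ i) +
      (x - x0) + (x - xb) = 0"
      unfolding 1 2 using g0 unfolding g_def by (simp add: algebra_simps)
  qed (use lampos lamsum xi eta in \<open>auto simp: less_imp_le\<close>)
qed

text \<open>Together \<open>ub\<close> and \<open>lb\<close> say that \<open>xb\<close> minimizes
  the maximum of the \<open>F l + R\<close> over the ball, with value \<open>V\<close>. Minimizers
  of the decoupled objective over a compact ball around the diagonal point \<open>P\<close> have
  value at most \<open>V + C / t\<close>, so the gaps between copies vanish as \<open>t\<close>
  grows. Every cluster point is thus diagonal, and the extra squared distance to \<open>xb\<close>
  identifies it as \<open>P\<close>. Late minimizers then lie in the open ball, hence are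
  unconstrained local minimizers.\<close>

lemma decoupled_minimizers:
  fixes F :: "'p::finite \<Rightarrow> 'a::euclidean_space \<Rightarrow> real" and G :: "'q::finite \<Rightarrow> 'a \<Rightarrow> real"
    and x0 xb :: 'a and c \<delta> V :: real
  assumes F: "\<And>l S. continuous_on S (F l)" and G: "\<And>i S. continuous_on S (G i)"
    and \<delta>: "\<delta> > 0"
  defines "R \<equiv> \<lambda>x. c / 2 * (\<Sum>i\<in>UNIV. (max (G i x) 0)\<^sup>2) + (norm (x - x0))\<^sup>2 / 2"
  assumes ub: "\<And>l. F l xb + R xb \<le> V"
    and lb: "\<And>x. x \<in> cball xb \<delta> \<Longrightarrow> \<exists>l. V \<le> F l x + R x"
  obtains t x y z where "\<And>k::nat. t k > 0" "(\<lambda>k. 1 / t k) \<longlonglongrightarrow> 0"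
    "x \<longlonglongrightarrow> xb" "\<And>l. (\<lambda>k. y k $ l) \<longlonglongrightarrow> xb" "\<And>i. (\<lambda>k. z k $ i) \<longlonglongrightarrow> xb"
    "\<And>k. \<forall>\<^sub>F v in nhds (x k, y k, z k). decoupled F G c x0 xb (t k) (x k) (y k) (z k) \<le>
           decoupled F G c x0 xb (t k) (fst v) (fst (snd v)) (snd (snd v))"
proof -
  define P :: "'a \<times> ('a ^ 'p) \<times> ('a ^ 'q)" where "P = (xb, (\<chi> l. xb), (\<chi> i. xb))"
  define K where "K = cball P \<delta>"
  define J where "J = (\<lambda>t v. decoupled F G c x0 xb t (fst v) (fst (snd v)) (snd (snd v)))"
  \<comment> \<open>\<open>D\<close> measures the decoupling, \<open>A\<close> collects the terms of
    weight \<open>1 / t\<close>, and \<open>Q l\<close> is what remains when the maximum is replaced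
    by its branch \<open>l\<close>.\<close>
  define D where "D = (\<lambda>v::'a \<times> ('a ^ 'p) \<times> ('a ^ 'q). (\<Sum>l\<in>UNIV. (norm (fst (snd v) $ l - fst v))\<^sup>2)
    + (\<Sum>i\<in>UNIV. (norm (snd (snd v) $ i - fst v))\<^sup>2))"
  define A where "A = (\<lambda>v::'a \<times> ('a ^ 'p) \<times> ('a ^ 'q). \<Sum>i\<in>UNIV. G i (snd (snd v) $ i))"
  define Q where "Q = (\<lambda>l (v::'a \<times> ('a ^ 'p) \<times> ('a ^ 'q)). F l (fst (snd v) $ l)
    + c / 2 * (\<Sum>i\<in>UNIV. (max (G i (snd (snd v) $ i)) 0)\<^sup>2)
    + (norm (fst v - x0))\<^sup>2 / 2 + (norm (fst v - xb))\<^sup>2 / 2)"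
  have contF: "continuous_on S (\<lambda>v. F l (f v))" if "continuous_on S f" for S l and f :: "_ \<Rightarrow> 'a"
    using continuous_on_compose2[OF F that] by blast
  have contG: "continuous_on S (\<lambda>v. G l (f v))" if "continuous_on S f" for S l and f :: "_ \<Rightarrow> 'a"
    using continuous_on_compose2[OF G that] by blast
  note ci = continuous_intros contF contG
  have contD: "continuous_on S D" for S unfolding D_def by (intro ci)
  have contA: "continuous_on S A" for S unfolding A_def by (intro ci)
  have contQ: "continuous_on S (Q l)" for S l unfolding Q_def by (intro ci) auto
  have esum: "(\<Sum>l\<in>UNIV. exp (u l :: real)) > 0" for u :: "'p \<Rightarrow> real"
    by (intro sum_pos) auto
  have contJ: "continuous_on S (J t)" if "t > 0" for S t
    unfolding J_def decoupled_def using that esum by (intro ci) (auto simp: less_imp_neq[symmetric])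

  \<comment> \<open>The shift by one keeps the weight positive at \<open>n = 0\<close>.\<close>
  define T where "T = (\<lambda>n::nat. real n + 1)"
  have T: "T n > 0" for n by (simp add: T_def add_nonneg_pos)
  have "compact K" "K \<noteq> {}" using \<delta> by (auto simp: K_def)
  then have "\<exists>v\<in>K. \<forall>u\<in>K. J (T n) v \<le> J (T n) u" for n
    using continuous_attains_inf contJ[OF T] by blast
  then obtain p where p: "\<And>n. p n \<in> K" "\<And>n u. u \<in> K \<Longrightarrow> J (T n) (p n) \<le> J (T n) u"
    by metis
  obtain q r where q: "q \<in> K" "strict_mono r" "(p \<circ> r) \<longlonglongrightarrow> q"
    using \<open>compact K\<close> p(1) by (metis seq_compactE compact_imp_seq_compact)
  \<comment> \<open>Log-sum-exp exceeds the maximum by at most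
    \<open>ln (real CARD('p)) / t\<close>; \<open>A P\<close> comes from the terms
    \<open>G i / t\<close> at \<open>P\<close>.\<close>
  define C where "C = ln (real CARD('p)) + A P"

  \<comment> \<open>From below, the sum of exponentials is bounded by its term \<open>l\<close>;
    from above, \<open>p n\<close> is compared with \<open>P\<close>.\<close>
  have est: "Q l (p n) + A (p n) / T n + T n / 2 * D (p n) \<le> V + C / T n" for l n
  proof -
    let ?t = "T n"
    have "Q l v + A v / ?t + ?t / 2 * D v \<le> J ?t v" for v
    proof -
      have "exp (?t * F l (fst (snd v) $ l)) \<le> (\<Sum>l\<in>UNIV. exp (?t * F l (fst (snd v) $ l)))"
        by (rule member_le_sum) auto
      from ln_mono[OF this] have "?t * F l (fst (snd v) $ l) \<le> ln (\<Sum>l\<in>UNIV. exp (?t * F l (fst (snd v) $ l)))"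
        using esum by simp
      then have "F l (fst (snd v) $ l) \<le> ln (\<Sum>l\<in>UNIV. exp (?t * F l (fst (snd v) $ l))) / ?t"
        using T[of n] by (simp add: field_simps)
      then show ?thesis
        by (simp add: J_def decoupled_def Q_def A_def D_def sum.distrib sum_distrib_left sum_divide_distrib)
    qed
    also have "J ?t (p n) \<le> J ?t P"
      using \<delta> by (intro p) (simp add: K_def)
    also have "J ?t P \<le> V + C / ?t"
    proof -
      have "(\<Sum>l\<in>UNIV. exp (?t * F l xb)) \<le> (\<Sum>l\<in>(UNIV::'p set). exp (?t * (V - R xb)))"
      proof (intro sum_mono, unfold exp_le_cancel_iff, rule mult_left_mono)
        show "F l xb \<le> V - R xb" for l
          using ub[of l] by simp
      qed (use T[of n] in simp)
      also have "\<dots> = real CARD('p) * exp (?t * (V - R xb))"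
        by simp
      finally have "ln (\<Sum>l\<in>UNIV. exp (?t * F l xb)) \<le> ln (real CARD('p) * exp (?t * (V - R xb)))"
        using esum by (intro ln_mono) auto
      also have "\<dots> = ln (real CARD('p)) + ?t * (V - R xb)"
        by (subst ln_mult) auto
      finally have "ln (\<Sum>l\<in>UNIV. exp (?t * F l xb)) / ?t \<le> ln (real CARD('p)) / ?t + (V - R xb)"
        using T[of n] by (simp add: field_simps)
      then show ?thesis
        by (simp add: J_def decoupled_def P_def C_def A_def R_def sum.distrib sum_distrib_left
            sum_divide_distrib add_divide_distrib)
    qed
    finally show ?thesis .
  qed

  have lim: "(\<lambda>k. f (p (r k))) \<longlonglongrightarrow> f q" if "\<And>S. continuous_on S f" for f :: "_ \<Rightarrow> real"
  proof -
    have "isCont f q"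
      using that[of UNIV] by (simp add: continuous_on_eq_continuous_at del: split_paired_All)
    then show ?thesis
      using q(3) unfolding comp_def by (rule isCont_tendsto_compose)
  qed
  have Tlim0: "(\<lambda>n. 1 / T n) \<longlonglongrightarrow> 0"
    using LIMSEQ_inverse_real_of_nat by (simp add: T_def inverse_eq_divide add.commute)
  have Tlim: "(\<lambda>k. 1 / T (r k)) \<longlonglongrightarrow> 0"
    using LIMSEQ_subseq_LIMSEQ[OF Tlim0 q(2)] by (simp add: comp_def)
  have D0: "D v \<ge> 0" for v unfolding D_def by (intro add_nonneg_nonneg sum_nonneg) auto
  have Dq: "D q = 0"
  proof -
    \<comment> \<open>This is \<open>est\<close> solved for \<open>D\<close>: the last factor
      converges, so \<open>1 / T (r k)\<close> drives the bound to \<open>0\<close>.\<close>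
    have le: "D (p (r k)) \<le> 2 * (1 / T (r k)) * (V + C * (1 / T (r k)) - Q l (p (r k)) - A (p (r k)) * (1 / T (r k)))" for k l
      using est[of l "r k"] T[of "r k"] by (simp add: field_simps)
    have "(\<lambda>k. 2 * (1 / T (r k)) * (V + C * (1 / T (r k)) - Q l (p (r k)) - A (p (r k)) * (1 / T (r k))))
        \<longlonglongrightarrow> 2 * 0 * (V + C * 0 - Q l q - A q * 0)" for l
      by (intro tendsto_intros Tlim lim contQ contA)
    then have "D q \<le> 0"
      using LIMSEQ_le[OF lim[OF contD]] le by fastforce
    then show ?thesis using D0[of q] by simp
  qed
  have Qq: "Q l q \<le> V" for l
  proof -
    have le: "Q l (p (r k)) \<le> V + C * (1 / T (r k)) - A (p (r k)) * (1 / T (r k))" for k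
    proof -
      have "0 \<le> T (r k) / 2 * D (p (r k))"
        using T[of "r k"] D0 by (intro mult_nonneg_nonneg) auto
      then have "Q l (p (r k)) \<le> V + C / T (r k) - A (p (r k)) / T (r k)"
        using est[of l "r k"] by linarith
      then show ?thesis by simp
    qed
    have "(\<lambda>k. V + C * (1 / T (r k)) - A (p (r k)) * (1 / T (r k))) \<longlonglongrightarrow> V + C * 0 - A q * 0"
      by (intro tendsto_intros Tlim lim contA)
    then show ?thesis
      using LIMSEQ_le[OF lim[OF contQ]] le by fastforce
  qed
  have yz: "fst (snd q) $ l = fst q" "snd (snd q) $ i = fst q" for l i
  proof -
    have "(\<Sum>l\<in>UNIV. (norm (fst (snd q) $ l - fst q))\<^sup>2) = 0 \<and> (\<Sum>i\<in>UNIV. (norm (snd (snd q) $ i - fst q))\<^sup>2) = 0"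
      using Dq unfolding D_def by (subst (asm) add_nonneg_eq_0_iff) (auto intro!: sum_nonneg)
    then show "fst (snd q) $ l = fst q" "snd (snd q) $ i = fst q"
      by (auto simp: sum_nonneg_eq_0_iff)
  qed
  have "fst q \<in> cball xb \<delta>"
    using q(1) dist_fst_le[of P q] by (auto simp: K_def P_def)
  \<comment> \<open>On the diagonal, \<open>Q l q\<close> is \<open>F l + R\<close> plus half the
    squared distance to \<open>xb\<close>, so \<open>Qq\<close> and \<open>lb\<close> leave no room
    for that distance.\<close>
  then obtain l where "V \<le> F l (fst q) + R (fst q)"
    using lb by blast
  then have "(norm (fst q - xb))\<^sup>2 \<le> 0"
    using Qq[of l] unfolding Q_def R_def yz by linarith
  then have "fst q = xb" by simp
  then have qP: "q = P"
    using yz by (simp add: P_def prod_eq_iff vec_eq_iff)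
  \<comment> \<open>Interior minimizers over \<open>K\<close> are local minimizers; the finitely
    many indices before \<open>N\<close> are dropped.\<close>
  have "\<forall>\<^sub>F k in sequentially. p (r k) \<in> ball P \<delta>"
    using q(3) \<delta> unfolding qP by (auto simp: comp_def tendsto_iff dist_commute)
  then obtain N where N: "\<And>k. k \<ge> N \<Longrightarrow> p (r k) \<in> ball P \<delta>"
    by (auto simp: eventually_sequentially)
  define s where "s = (\<lambda>k. r (k + N))"
  have "(\<lambda>k. p (s k)) \<longlonglongrightarrow> P"
    using LIMSEQ_ignore_initial_segment[OF q(3), of N] by (simp add: qP s_def comp_def)
  note conv = this tendsto_fst[OF this] tendsto_fst[OF tendsto_snd[OF this]] tendsto_snd[OF tendsto_snd[OF this]]
  show ?thesis
  proof (rule that[of "\<lambda>k. T (s k)" "\<lambda>k. fst (p (s k))" "\<lambda>k. fst (snd (p (s k)))" "\<lambda>k. snd (snd (p (s k)))"])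
    show "(\<lambda>k. 1 / T (s k)) \<longlonglongrightarrow> 0"
      using LIMSEQ_ignore_initial_segment[OF Tlim, of N] by (simp add: s_def)
    show "(\<lambda>k. fst (snd (p (s k))) $ l) \<longlonglongrightarrow> xb" for l
      using tendsto_vec_nth[OF conv(3), of l] by (simp add: P_def)
    show "(\<lambda>k. snd (snd (p (s k))) $ i) \<longlonglongrightarrow> xb" for i
      using tendsto_vec_nth[OF conv(4), of i] by (simp add: P_def)
    show "\<forall>\<^sub>F v in nhds (fst (p (s k)), fst (snd (p (s k))), snd (snd (p (s k)))).
        decoupled F G c x0 xb (T (s k)) (fst (p (s k))) (fst (snd (p (s k)))) (snd (snd (p (s k))))
        \<le> decoupled F G c x0 xb (T (s k)) (fst v) (fst (snd v)) (snd (snd v))" for k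
    proof -
      have "\<forall>\<^sub>F v in nhds (p (s k)). v \<in> ball P \<delta>"
        using N[of "k + N"] by (intro eventually_nhds_in_open) (auto simp: s_def)
      then have "\<forall>\<^sub>F v in nhds (p (s k)). J (T (s k)) (p (s k)) \<le> J (T (s k)) v"
        by eventually_elim (auto intro!: p simp: K_def)
      then show ?thesis
        by (simp add: J_def)
    qed
  qed (use T conv in \<open>auto simp: P_def\<close>)
qed

section \<open>Multiplier rule for penalized minimax problems\<close>

text \<open>Each copy eventually enters a neighborhood of \<open>xb\<close> with a fixed Lipschitz
  constant, and there are finitely many copies. The bound provides the compactness for passing to
  limiting subgradients.\<close>

lemma eventually_frechet_subgradients_bounded:
  fixes F :: "'p::finite \<Rightarrow> 'a::euclidean_space \<Rightarrow> real" and \<xi> :: "nat \<Rightarrow> 'a ^ 'p"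
  assumes F: "\<And>l. locally_lipschitz (F l)" and y: "\<And>l. (\<lambda>k. y k $ l) \<longlonglongrightarrow> xb"
    and \<xi>: "\<And>k l. \<xi> k $ l \<in> frechet_subdifferential (F l) (y k $ l)"
  obtains B where "\<forall>\<^sub>F k in sequentially. norm (\<xi> k) \<le> B"
proof -
  have "\<exists>L. \<forall>\<^sub>F k in sequentially. norm (\<xi> k $ l) \<le> L" for l
  proof -
    obtain U L where U: "open U" "xb \<in> U" "L-lipschitz_on U (F l)"
      using locally_lipschitzE[OF F] by metis
    have "\<forall>\<^sub>F k in sequentially. y k $ l \<in> U"
      using topological_tendstoD[OF y U(1,2)] .
    then have "\<forall>\<^sub>F k in sequentially. norm (\<xi> k $ l) \<le> L"
      by eventually_elim (rule frechet_subdifferential_norm_le[OF U(1) _ U(3) \<xi>])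
    then show ?thesis ..
  qed
  then obtain L where "\<And>l. \<forall>\<^sub>F k in sequentially. norm (\<xi> k $ l) \<le> L l"
    by metis
  then have "\<forall>\<^sub>F k in sequentially. \<forall>l. norm (\<xi> k $ l) \<le> L l"
    by (rule eventually_all_finite)
  then have "\<forall>\<^sub>F k in sequentially. norm (\<xi> k) \<le> (\<Sum>l\<in>UNIV. L l)"
  proof eventually_elim
    case (elim k)
    have "norm (\<xi> k) \<le> (\<Sum>l\<in>UNIV. norm (\<xi> k $ l))"
      unfolding norm_vec_def by (intro L2_set_le_sum) auto
    also have "\<dots> \<le> (\<Sum>l\<in>UNIV. L l)"
      using elim by (intro sum_mono) auto
    finally show ?case .
  qed
  then show ?thesis by (rule that)
qed

lemma locally_lipschitz_diff_const:
  assumes "locally_lipschitz \<phi>"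
  shows "locally_lipschitz (\<lambda>x. \<phi> x - a)"
  using assms unfolding locally_lipschitz_def lipschitz_on_def by (simp add: dist_real_def)

text \<open>The offsets \<open>a\<close> spare a translation rule for limiting subdifferentials.\<close>
lemma minimax_penalty_multipliers:
  fixes F :: "'p::finite \<Rightarrow> 'a::euclidean_space \<Rightarrow> real" and G :: "'q::finite \<Rightarrow> 'a \<Rightarrow> real"
    and a :: "'p \<Rightarrow> real" and x0 xb :: 'a and c \<delta> V :: real
  assumes F: "\<And>l. locally_lipschitz (F l)" and G: "\<And>i. locally_lipschitz (G i)"
    and c: "c \<ge> 0" and \<delta>: "\<delta> > 0"
  defines "R \<equiv> \<lambda>x. c / 2 * (\<Sum>i\<in>UNIV. (max (G i x) 0)\<^sup>2) + (norm (x - x0))\<^sup>2 / 2"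
  assumes ub: "\<And>l. F l xb - a l + R xb \<le> V"
    and lb: "\<And>x. x \<in> cball xb \<delta> \<Longrightarrow> \<exists>l. V \<le> F l x - a l + R x"
  obtains lam :: "real ^ 'p" and \<xi> :: "'p \<Rightarrow> 'a" and \<eta> :: "'q \<Rightarrow> 'a" where
    "\<And>l. 0 \<le> lam $ l" "(\<Sum>l\<in>UNIV. lam $ l) = 1"
    "\<And>l. \<xi> l \<in> limiting_subdifferential (F l) xb"
    "\<And>i. \<eta> i \<in> limiting_subdifferential (G i) xb"
    "(\<Sum>l\<in>UNIV. lam $ l *\<^sub>R \<xi> l) + (\<Sum>i\<in>UNIV. (c * max (G i xb) 0) *\<^sub>R \<eta> i) = x0 - xb"
proof -
  define F' where "F' = (\<lambda>l u. F l u - a l)"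
  have F': "locally_lipschitz (F' l)" for l
    unfolding F'_def by (rule locally_lipschitz_diff_const[OF F])
  \<comment> \<open>The offset cancels in the subgradient inequality, so the limits below are taken
    for \<open>F l\<close> itself.\<close>
  have fr: "frechet_subdifferential (F' l) u = frechet_subdifferential (F l) u" for l u
    by (simp add: frechet_subdifferential_def F'_def algebra_simps)
  have ub': "F' l xb + (c / 2 * (\<Sum>i\<in>UNIV. (max (G i xb) 0)\<^sup>2) + (norm (xb - x0))\<^sup>2 / 2) \<le> V" for l
    using ub[of l] by (simp add: F'_def R_def)
  have lb': "\<exists>l. V \<le> F' l x + (c / 2 * (\<Sum>i\<in>UNIV. (max (G i x) 0)\<^sup>2) + (norm (x - x0))\<^sup>2 / 2)"
    if "x \<in> cball xb \<delta>" for x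
    using lb[OF that] by (simp add: F'_def R_def)
  obtain t x and y :: "nat \<Rightarrow> 'a ^ 'p" and z :: "nat \<Rightarrow> 'a ^ 'q" where
    t: "\<And>k::nat. t k > 0" "(\<lambda>k. 1 / t k) \<longlonglongrightarrow> 0"
    and x: "x \<longlonglongrightarrow> xb" and y: "\<And>l. (\<lambda>k. y k $ l) \<longlonglongrightarrow> xb" and z: "\<And>i. (\<lambda>k. z k $ i) \<longlonglongrightarrow> xb"
    and min: "\<And>k. \<forall>\<^sub>F v in nhds (x k, y k, z k). decoupled F' G c x0 xb (t k) (x k) (y k) (z k) \<le>
           decoupled F' G c x0 xb (t k) (fst v) (fst (snd v)) (snd (snd v))"
    using decoupled_minimizers[OF locally_lipschitz_continuous_on[OF F']
        locally_lipschitz_continuous_on[OF G] \<delta> ub' lb']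
    by blast
  \<comment> \<open>Weights and both families of subgradients are bundled into one point of a
    product space, so that a single subsequence makes all of them converge.\<close>
  define stat where "stat = (\<lambda>k (w :: (real ^ 'p) \<times> ('a ^ 'p) \<times> ('a ^ 'q)).
    (\<forall>l. 0 \<le> fst w $ l) \<and> (\<Sum>l\<in>UNIV. fst w $ l) = 1
    \<and> (\<forall>l. fst (snd w) $ l \<in> frechet_subdifferential (F' l) (y k $ l))
    \<and> (\<forall>i. snd (snd w) $ i \<in> frechet_subdifferential (G i) (z k $ i))
    \<and> (\<Sum>l\<in>UNIV. fst w $ l *\<^sub>R fst (snd w) $ l)
     + (\<Sum>i\<in>UNIV. (c * max (G i (z k $ i)) 0 + 1 / t k) *\<^sub>R snd (snd w) $ i) + (x k - x0) + (x k - xb) = 0)"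
  have "\<exists>w. stat k w" for k
  proof (rule decoupled_stationary[OF F' G t(1) c min[of k]])
    fix lam :: "real ^ 'p" and \<xi> :: "'a ^ 'p" and \<eta> :: "'a ^ 'q"
    assume "\<And>l. 0 \<le> lam $ l" "(\<Sum>l\<in>UNIV. lam $ l) = 1"
      "\<And>l. \<xi> $ l \<in> frechet_subdifferential (F' l) (y k $ l)"
      "\<And>i. \<eta> $ i \<in> frechet_subdifferential (G i) (z k $ i)"
      "(\<Sum>l\<in>UNIV. lam $ l *\<^sub>R \<xi> $ l)
       + (\<Sum>i\<in>UNIV. (c * max (G i (z k $ i)) 0 + 1 / t k) *\<^sub>R \<eta> $ i) + (x k - x0) + (x k - xb) = 0"
    then show ?thesis
      by (intro exI[of _ "(lam, \<xi>, \<eta>)"]) (simp add: stat_def)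
  qed
  then obtain w where "\<And>k. stat k (w k)"
    by metis
  then have w: "\<And>k l. 0 \<le> fst (w k) $ l" "\<And>k. (\<Sum>l\<in>UNIV. fst (w k) $ l) = 1"
    "\<And>k l. fst (snd (w k)) $ l \<in> frechet_subdifferential (F l) (y k $ l)"
    "\<And>k i. snd (snd (w k)) $ i \<in> frechet_subdifferential (G i) (z k $ i)"
    "\<And>k. (\<Sum>l\<in>UNIV. fst (w k) $ l *\<^sub>R fst (snd (w k)) $ l)
     + (\<Sum>i\<in>UNIV. (c * max (G i (z k $ i)) 0 + 1 / t k) *\<^sub>R snd (snd (w k)) $ i)
     + (x k - x0) + (x k - xb) = 0"
    by (simp_all add: stat_def fr)
  obtain B1 where B1: "\<forall>\<^sub>F k in sequentially. norm (fst (snd (w k))) \<le> B1"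
    using eventually_frechet_subgradients_bounded[OF F y w(3)] .
  obtain B2 where B2: "\<forall>\<^sub>F k in sequentially. norm (snd (snd (w k))) \<le> B2"
    using eventually_frechet_subgradients_bounded[OF G z w(4)] .
  have B0: "norm (fst (w k)) \<le> 1" for k
  proof -
    have "norm (fst (w k)) \<le> (\<Sum>l\<in>UNIV. norm (fst (w k) $ l))"
      unfolding norm_vec_def by (intro L2_set_le_sum) auto
    then show ?thesis using w(1,2)[of k] by simp
  qed
  have "\<forall>\<^sub>F k in sequentially. w k \<in> cball 0 (1 + (B1 + B2))"
    using B1 B2
  proof eventually_elim
    case (elim k)
    then show ?case
      using B0[of k] norm_Pair_le[of "fst (w k)" "snd (w k)"]
        norm_Pair_le[of "fst (snd (w k))" "snd (snd (w k))"] by simp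
  qed
  then obtain N where "\<And>k. k \<ge> N \<Longrightarrow> w k \<in> cball 0 (1 + (B1 + B2))"
    by (auto simp: eventually_sequentially)
  then have "\<forall>k. w (k + N) \<in> cball 0 (1 + (B1 + B2))"
    by simp
  then obtain W r where r: "strict_mono r" "((\<lambda>k. w (k + N)) \<circ> r) \<longlonglongrightarrow> W"
    using seq_compactE[OF compact_imp_seq_compact[OF compact_cball]] by metis
  define s where "s = (\<lambda>k. r k + N)"
  have s: "strict_mono s"
    using r(1) by (auto simp: s_def strict_mono_def)
  have W: "(\<lambda>k. w (s k)) \<longlonglongrightarrow> W"
    using r(2) by (simp add: s_def comp_def)
  note Ws = tendsto_fst[OF W] tendsto_fst[OF tendsto_snd[OF W]] tendsto_snd[OF tendsto_snd[OF W]]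
  have sub: "(\<lambda>k. X (s k)) \<longlonglongrightarrow> L" if "X \<longlonglongrightarrow> L" for X and L :: "'b::topological_space"
    using LIMSEQ_subseq_LIMSEQ[OF that s] by (simp add: comp_def)
  show ?thesis
  proof (rule that[of "fst W" "\<lambda>l. fst (snd W) $ l" "\<lambda>i. snd (snd W) $ i"])
    show "0 \<le> fst W $ l" for l
      using tendsto_vec_nth[OF Ws(1), of l] w(1) by (intro LIMSEQ_le_const) auto
    have "(\<lambda>k. \<Sum>l\<in>UNIV. fst (w (s k)) $ l) \<longlonglongrightarrow> (\<Sum>l\<in>UNIV. fst W $ l)"
      by (intro tendsto_intros Ws)
    then show "(\<Sum>l\<in>UNIV. fst W $ l) = 1"
      by (simp add: w(2) LIMSEQ_const_iff)
    show "fst (snd W) $ l \<in> limiting_subdifferential (F l) xb" for l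
      by (rule limiting_subdifferentialI[OF sub[OF y] tendsto_vec_nth[OF Ws(2)]
            locally_lipschitz_isCont[OF F] w(3)])
    show "snd (snd W) $ i \<in> limiting_subdifferential (G i) xb" for i
      by (rule limiting_subdifferentialI[OF sub[OF z] tendsto_vec_nth[OF Ws(3)]
            locally_lipschitz_isCont[OF G] w(4)])
    have "(\<lambda>k. G i (z (s k) $ i)) \<longlonglongrightarrow> G i xb" for i
      by (rule isCont_tendsto_compose[OF locally_lipschitz_isCont[OF G] sub[OF z]])
    \<comment> \<open>The left side is \<open>0\<close> for every \<open>k\<close>. In the limit
      \<open>1 / t\<close> and \<open>x - xb\<close> disappear, and \<open>x0 - xb\<close> is the
      residual of the proximal term.\<close>
    then have "(\<lambda>k. (\<Sum>l\<in>UNIV. fst (w (s k)) $ l *\<^sub>R fst (snd (w (s k))) $ l)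
        + (\<Sum>i\<in>UNIV. (c * max (G i (z (s k) $ i)) 0 + 1 / t (s k)) *\<^sub>R snd (snd (w (s k))) $ i)
        + (x (s k) - x0) + (x (s k) - xb))
      \<longlonglongrightarrow> (\<Sum>l\<in>UNIV. fst W $ l *\<^sub>R fst (snd W) $ l)
        + (\<Sum>i\<in>UNIV. (c * max (G i xb) 0 + 0) *\<^sub>R snd (snd W) $ i) + (xb - x0) + (xb - xb)"
      by (intro tendsto_intros Ws sub[OF x] sub[OF t(2)])
    then show "(\<Sum>l\<in>UNIV. fst W $ l *\<^sub>R fst (snd W) $ l)
        + (\<Sum>i\<in>UNIV. (c * max (G i xb) 0) *\<^sub>R snd (snd W) $ i) = x0 - xb"
      unfolding w(5) by (simp add: LIMSEQ_const_iff algebra_simps)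
  qed
qed

section \<open>Penalty minimizers at a weakly efficient point\<close>

lemma continuous_on_Max:
  fixes F :: "'i \<Rightarrow> 'a::topological_space \<Rightarrow> real"
  assumes "finite I" "I \<noteq> {}" "\<And>i. i \<in> I \<Longrightarrow> continuous_on S (F i)"
  shows "continuous_on S (\<lambda>x. Max ((\<lambda>i. F i x) ` I))"
  using assms
proof (induction I rule: finite_ne_induct)
  case (insert i I)
  then have "continuous_on S (\<lambda>x. max (F i x) (Max ((\<lambda>i. F i x) ` I)))"
    by (intro continuous_on_max) auto
  then show ?case
    using insert by simp
qed simp

lemma sum_UNIV_Plus:
  fixes f :: "'a::finite + 'b::finite \<Rightarrow> 'c::comm_monoid_add"
  shows "sum f UNIV = (\<Sum>i\<in>UNIV. f (Inl i)) + (\<Sum>j\<in>UNIV. f (Inr j))"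
  by (subst UNIV_Plus_UNIV[symmetric], subst sum.Plus) (auto simp: comp_def)

text \<open>The penalty function vanishes at \<open>x0\<close> for every \<open>c\<close>, so its
  minima are nonpositive and infeasibility tends to \<open>0\<close> as \<open>c\<close> grows. A
  cluster point is feasible; weak efficiency provides a component that has not decreased there, and
  the proximal term then forces the point to be \<open>x0\<close>. The numbers \<open>V k\<close>
  encode minimality of a maximum in the form that the multiplier rule takes.\<close>

lemma penalty_minimizers:
  fixes f :: "'a::euclidean_space \<Rightarrow> real ^ 'p" and g :: "'a \<Rightarrow> real ^ 'm"
    and h :: "'a \<Rightarrow> real ^ 'r" and x0 :: 'a
  assumes f: "\<And>l S. continuous_on S (\<lambda>x. f x $ l)" and g: "\<And>i S. continuous_on S (\<lambda>x. g x $ i)"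
    and h: "\<And>j S. continuous_on S (\<lambda>x. h x $ j)"
    and eff: "local_weak_efficient f (feasible_set g h) x0"
  defines "R \<equiv> \<lambda>c x. c / 2 * ((\<Sum>i\<in>UNIV. (max (g x $ i) 0)\<^sup>2) + (\<Sum>j\<in>UNIV. (h x $ j)\<^sup>2))
    + (norm (x - x0))\<^sup>2 / 2"
  obtains x c \<delta> V where "x \<longlonglongrightarrow> x0" "\<And>k::nat. c k > 0" "\<And>k. \<delta> k > 0" "\<And>k. V k \<le> 0"
    "\<And>k l. f (x k) $ l - f x0 $ l + R (c k) (x k) \<le> V k"
    "\<And>k u. u \<in> cball (x k) (\<delta> k) \<Longrightarrow> \<exists>l. V k \<le> f u $ l - f x0 $ l + R (c k) u"
proof -
  have feas: "x0 \<in> feasible_set g h"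
    using eff by (simp add: local_weak_efficient_def)
  obtain U where U: "open U" "x0 \<in> U" "\<And>u. u \<in> U \<Longrightarrow> u \<in> feasible_set g h \<Longrightarrow> \<exists>l. f x0 $ l \<le> f u $ l"
    using eff unfolding local_weak_efficient_def by (force simp: not_less)
  \<comment> \<open>A closed ball inside \<open>U\<close> gives compactness and keeps cluster points
    where efficiency applies.\<close>
  obtain d where d: "d > 0" "cball x0 d \<subseteq> U"
    using U open_contains_cball by blast
  define M where "M = (\<lambda>x. Max (range (\<lambda>l. f x $ l - f x0 $ l)))"
  have le_M: "f x $ l - f x0 $ l \<le> M x" for x l
    unfolding M_def by (intro Max_ge) auto
  have M_ex: "\<exists>l. M x = f x $ l - f x0 $ l" for x
  proof -
    have "M x \<in> range (\<lambda>l. f x $ l - f x0 $ l)"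
      unfolding M_def by (intro Max_in) auto
    then show ?thesis by blast
  qed
  define A where "A = (\<lambda>x. (\<Sum>i\<in>UNIV. (max (g x $ i) 0)\<^sup>2) + (\<Sum>j\<in>UNIV. (h x $ j)\<^sup>2))"
  have R_A: "R c x = c / 2 * A x + (norm (x - x0))\<^sup>2 / 2" for c x
    by (simp add: R_def A_def)
  have contA: "continuous_on S A" for S
    unfolding A_def by (intro continuous_intros g h)
  have cont: "continuous_on S (\<lambda>x. M x + R c x)" for S c
    unfolding R_A M_def by (intro continuous_intros continuous_on_Max f contA) auto
  have A0: "A x \<ge> 0" for x unfolding A_def by (intro add_nonneg_nonneg sum_nonneg) auto
  have "A x0 = 0" using feas by (simp add: A_def feasible_set_def max_def)
  moreover have "M x0 = 0" using M_ex[of x0] by simp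
  ultimately have at_x0: "M x0 + R c x0 = 0" for c by (simp add: R_A)

  define T where "T = (\<lambda>n::nat. real n + 1)"
  have T: "T n > 0" for n by (simp add: T_def add_nonneg_pos)
  have "\<exists>u\<in>cball x0 d. \<forall>v\<in>cball x0 d. M u + R (T n) u \<le> M v + R (T n) v" for n
    using continuous_attains_inf[OF compact_cball _ cont] d by auto
  then obtain p where p: "\<And>n. p n \<in> cball x0 d"
      "\<And>n v. v \<in> cball x0 d \<Longrightarrow> M (p n) + R (T n) (p n) \<le> M v + R (T n) v"
    by metis
  have neg: "M (p n) + R (T n) (p n) \<le> 0" for n
    using p(2)[of x0 n] d at_x0 by simp
  obtain q r where q: "q \<in> cball x0 d" "strict_mono r" "(p \<circ> r) \<longlonglongrightarrow> q"
    using p(1) by (metis seq_compactE compact_imp_seq_compact compact_cball)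
  have lim: "(\<lambda>k. F (p (r k))) \<longlonglongrightarrow> F q" if "\<And>S. continuous_on S F" for F :: "_ \<Rightarrow> real"
    using that[of UNIV] q(3)
    by (auto simp: continuous_on_eq_continuous_at comp_def intro: isCont_tendsto_compose)
  have Tlim0: "(\<lambda>n. 1 / T n) \<longlonglongrightarrow> 0"
    using LIMSEQ_inverse_real_of_nat by (simp add: T_def inverse_eq_divide add.commute)
  have Tlim: "(\<lambda>k. 1 / T (r k)) \<longlonglongrightarrow> 0"
    using LIMSEQ_subseq_LIMSEQ[OF Tlim0 q(2)] by (simp add: comp_def)
  have est: "f (p n) $ l - f x0 $ l + T n / 2 * A (p n) + (norm (p n - x0))\<^sup>2 / 2 \<le> 0" for n l
    using neg[of n] le_M[of "p n" l] by (simp add: R_A)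
  have "A q = 0"
  proof -
    \<comment> \<open>Any component \<open>l\<close> will do: \<open>f\<close> converges along the
      subsequence while the penalty weight tends to infinity.\<close>
    have le: "A (p (r k)) \<le> 2 * (1 / T (r k)) * (f x0 $ l - f (p (r k)) $ l)" for k l
    proof -
      have "T (r k) / 2 * A (p (r k)) \<le> f x0 $ l - f (p (r k)) $ l"
        using est[of "r k" l] zero_le_power2[of "norm (p (r k) - x0)"] by linarith
      then show ?thesis using T[of "r k"] by (simp add: field_simps)
    qed
    have "(\<lambda>k. 2 * (1 / T (r k)) * (f x0 $ l - f (p (r k)) $ l)) \<longlonglongrightarrow> 2 * 0 * (f x0 $ l - f q $ l)" for l
      by (intro tendsto_mult tendsto_const tendsto_diff Tlim lim f)
    then have "A q \<le> 2 * 0 * (f x0 $ l - f q $ l)" for l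
      by (rule LIMSEQ_le[OF lim[OF contA]]) (use le in blast)
    then show ?thesis using A0[of q] by simp
  qed
  then have "(\<Sum>i\<in>UNIV. (max (g q $ i) 0)\<^sup>2) = 0 \<and> (\<Sum>j\<in>UNIV. (h q $ j)\<^sup>2) = 0"
    unfolding A_def by (subst (asm) add_nonneg_eq_0_iff) (auto intro!: sum_nonneg)
  then have "q \<in> feasible_set g h"
    by (auto simp: sum_nonneg_eq_0_iff feasible_set_def max_def split: if_splits)
  then obtain l where l: "f x0 $ l \<le> f q $ l"
    using U(3) d q(1) by blast
  have "f q $ l - f x0 $ l + (norm (q - x0))\<^sup>2 / 2 \<le> 0"
  proof (rule LIMSEQ_le_const2)
    show "(\<lambda>k. f (p (r k)) $ l - f x0 $ l + (norm (p (r k) - x0))\<^sup>2 / 2)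
        \<longlonglongrightarrow> f q $ l - f x0 $ l + (norm (q - x0))\<^sup>2 / 2"
      by (rule lim) (intro continuous_intros f, simp)
    show "\<exists>N. \<forall>k\<ge>N. f (p (r k)) $ l - f x0 $ l + (norm (p (r k) - x0))\<^sup>2 / 2 \<le> 0"
    proof (intro exI allI impI)
      fix k
      have "0 \<le> T (r k) / 2 * A (p (r k))"
        using T[of "r k"] A0 by (intro mult_nonneg_nonneg) auto
      then show "f (p (r k)) $ l - f x0 $ l + (norm (p (r k) - x0))\<^sup>2 / 2 \<le> 0"
        using est[of "r k" l] by linarith
    qed
  qed
  then have "(norm (q - x0))\<^sup>2 \<le> 0" using l by linarith
  then have qx0: "q = x0" by simp
  have "\<forall>\<^sub>F k in sequentially. p (r k) \<in> ball x0 d"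
    using q(3) d unfolding qx0 by (auto simp: comp_def tendsto_iff dist_commute)
  then obtain N where N: "\<And>k. k \<ge> N \<Longrightarrow> p (r k) \<in> ball x0 d"
    by (auto simp: eventually_sequentially)
  define s where "s = (\<lambda>k. r (k + N))"
  have "p (s k) \<in> ball x0 d" for k using N by (simp add: s_def)
  \<comment> \<open>Minimality over \<open>cball x0 d\<close> is inherited by a small ball around
    each \<open>p (s k)\<close>.\<close>
  then have "\<exists>e>0. cball (p (s k)) e \<subseteq> ball x0 d" for k
    using open_contains_cball by blast
  then obtain \<delta> where \<delta>: "\<And>k. \<delta> k > 0" "\<And>k. cball (p (s k)) (\<delta> k) \<subseteq> ball x0 d"
    by metis
  show ?thesis
  proof (rule that[of "\<lambda>k. p (s k)" "\<lambda>k. T (s k)" \<delta> "\<lambda>k. M (p (s k)) + R (T (s k)) (p (s k))"])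
    show "(\<lambda>k. p (s k)) \<longlonglongrightarrow> x0"
      using LIMSEQ_ignore_initial_segment[OF q(3), of N] by (simp add: qx0 s_def comp_def)
    show "\<exists>l. M (p (s k)) + R (T (s k)) (p (s k)) \<le> f u $ l - f x0 $ l + R (T (s k)) u"
      if "u \<in> cball (p (s k)) (\<delta> k)" for k u
    proof -
      have "u \<in> cball x0 d" using that \<delta>(2)[of k] by auto
      with p(2)[of u "s k"] M_ex[of u] show ?thesis by auto
    qed
  qed (use T \<delta> neg le_M in auto)
qed

section \<open>The AKKT condition from penalty minimizers\<close>

lemma stationarity_measure_nonneg: "0 \<le> stationarity_measure f g h x lam mu tau"
  unfolding stationarity_measure_def by (auto intro!: Inf_greatest)

text \<open>The multiplier rule leaves the residual \<open>x0 - xb\<close>, whose norm is the bound.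
  Each equality constraint enters twice, as \<open>h j\<close> and as \<open>- h j\<close>, which
  accounts for the index type \<open>'m + ('r + 'r)\<close>.\<close>

lemma stationarity_measure_at_penalty_minimizer:
  fixes f :: "'a::euclidean_space \<Rightarrow> real ^ 'p" and g :: "'a \<Rightarrow> real ^ 'm"
    and h :: "'a \<Rightarrow> real ^ 'r" and x0 xb :: 'a and c \<delta> V :: real
  assumes f: "\<And>l. locally_lipschitz (\<lambda>x. f x $ l)" and g: "\<And>i. locally_lipschitz (\<lambda>x. g x $ i)"
    and h: "\<And>j. locally_lipschitz (\<lambda>x. h x $ j)"
    and c: "c > 0" and \<delta>: "\<delta> > 0"
  defines "R \<equiv> \<lambda>x. c / 2 * ((\<Sum>i\<in>UNIV. (max (g x $ i) 0)\<^sup>2) + (\<Sum>j\<in>UNIV. (h x $ j)\<^sup>2))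
    + (norm (x - x0))\<^sup>2 / 2"
  assumes ub: "\<And>l. f xb $ l - f x0 $ l + R xb \<le> V"
    and lb: "\<And>u. u \<in> cball xb \<delta> \<Longrightarrow> \<exists>l. V \<le> f u $ l - f x0 $ l + R u"
  obtains lam :: "real ^ 'p" where "\<And>l. 0 \<le> lam $ l" "(\<Sum>l\<in>UNIV. lam $ l) = 1"
    "stationarity_measure f g h xb lam (\<chi> i. c * max (g xb $ i) 0) (\<chi> j. c * \<bar>h xb $ j\<bar>)
       \<le> ereal (norm (xb - x0))"
proof -
  define G :: "'m + ('r + 'r) \<Rightarrow> 'a \<Rightarrow> real" where
    "G = case_sum (\<lambda>i x. g x $ i) (case_sum (\<lambda>j x. h x $ j) (\<lambda>j x. - h x $ j))"
  have G: "locally_lipschitz (G i)" for i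
    by (auto simp: G_def g h intro: locally_lipschitz_uminus split: sum.split)
  have sq: "(max u 0)\<^sup>2 + (max (- u) 0)\<^sup>2 = u\<^sup>2" for u :: real
    by (auto simp: max_def)
  have R: "c / 2 * (\<Sum>i\<in>UNIV. (max (G i x) 0)\<^sup>2) + (norm (x - x0))\<^sup>2 / 2 = R x" for x
    unfolding R_def sum_UNIV_Plus sum.distrib[symmetric] by (simp add: G_def sq)
  obtain lam :: "real ^ 'p" and \<xi> \<eta> where *:
    "\<And>l. 0 \<le> lam $ l" "(\<Sum>l\<in>UNIV. lam $ l) = 1"
    "\<And>l. \<xi> l \<in> limiting_subdifferential (\<lambda>x. f x $ l) xb"
    "\<And>i. \<eta> i \<in> limiting_subdifferential (G i) xb"
    "(\<Sum>l\<in>UNIV. lam $ l *\<^sub>R \<xi> l) + (\<Sum>i\<in>UNIV. (c * max (G i xb) 0) *\<^sub>R \<eta> i) = x0 - xb"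
    using minimax_penalty_multipliers[of "\<lambda>l x. f x $ l" G c \<delta> xb "\<lambda>l. f x0 $ l" x0 V, unfolded R,
          OF f G less_imp_le[OF c] \<delta> ub lb] by blast
  \<comment> \<open>Keeps the side whose multiplier may be nonzero; at \<open>h xb $ j = 0\<close>
    both multipliers vanish and either choice is valid.\<close>
  define \<gamma> where "\<gamma> = (\<lambda>j. if h xb $ j \<ge> 0 then \<eta> (Inr (Inl j)) else \<eta> (Inr (Inr j)))"
  have \<gamma>: "(c * max (h xb $ j) 0) *\<^sub>R \<eta> (Inr (Inl j)) + (c * max (- h xb $ j) 0) *\<^sub>R \<eta> (Inr (Inr j))
      = (c * \<bar>h xb $ j\<bar>) *\<^sub>R \<gamma> j" for j
    by (auto simp: \<gamma>_def max_def)
  have sum: "(\<Sum>l\<in>UNIV. lam $ l *\<^sub>R \<xi> l) + (\<Sum>i\<in>UNIV. (c * max (g xb $ i) 0) *\<^sub>R \<eta> (Inl i))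
      + (\<Sum>j\<in>UNIV. (c * \<bar>h xb $ j\<bar>) *\<^sub>R \<gamma> j) = x0 - xb"
    using *(5) unfolding sum_UNIV_Plus sum.distrib[symmetric] by (simp add: G_def \<gamma> add.assoc)
  have "stationarity_measure f g h xb lam (\<chi> i. c * max (g xb $ i) 0) (\<chi> j. c * \<bar>h xb $ j\<bar>)
      \<le> ereal (norm (x0 - xb))"
    unfolding stationarity_measure_def
  proof (rule Inf_lower, unfold mem_Collect_eq, intro exI conjI allI)
    show "\<eta> (Inl i) \<in> limiting_subdifferential (\<lambda>y. g y $ i) xb" for i
      using *(4)[of "Inl i"] by (simp add: G_def)
    show "\<gamma> j \<in> limiting_subdifferential (\<lambda>y. h y $ j) xb
        \<union> limiting_subdifferential (\<lambda>y. - h y $ j) xb" for j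
      using *(4)[of "Inr (Inl j)"] *(4)[of "Inr (Inr j)"] by (simp add: G_def \<gamma>_def)
  qed (use *(3) sum in auto)
  with *(1,2) show ?thesis
    by (intro that[of lam]) (auto simp: norm_minus_commute)
qed

text \<open>The absolute value of \<open>h j\<close> leaves the sign to the subgradient. Demanding
  \<open>h (x k) $ j \<ge> 0\<close> itself would fail: on the real line with
  \<open>f = h = id\<close>, \<open>g = -1\<close> and \<open>x0 = 0\<close>, (E2) would force
  \<open>x k = 0\<close>, hence \<open>tau k = 0\<close> and a stationarity measure of
  \<open>1\<close>.\<close>

theorem theorem3p1:
  fixes f :: "real ^ 'n \<Rightarrow> real ^ 'p" and g :: "real ^ 'n \<Rightarrow> real ^ 'm"
    and h :: "real ^ 'n \<Rightarrow> real ^ 'r" and x0 :: "real ^ 'n"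
  assumes "\<And>l. locally_lipschitz (\<lambda>x. f x $ l)"
    and "\<And>i. locally_lipschitz (\<lambda>x. g x $ i)"
    and "\<And>j. locally_lipschitz (\<lambda>x. h x $ j)"
    and "local_weak_efficient f (feasible_set g h) x0"
  shows "\<exists>(x :: nat \<Rightarrow> real ^ 'n) (lam :: nat \<Rightarrow> real ^ 'p) (mu :: nat \<Rightarrow> real ^ 'm)
            (tau :: nat \<Rightarrow> real ^ 'r) (b :: nat \<Rightarrow> real) (c :: nat \<Rightarrow> real).
           AKKT f g h x0 x lam mu tau \<and>
           (\<forall>k. b k > 0 \<and> c k > 0) \<and>
           (\<forall>k i. mu k $ i = b k * max (g (x k) $ i) 0 \<and> mu k $ i \<ge> 0) \<and>
           (\<forall>k j. tau k $ j = c k * \<bar>h (x k) $ j\<bar> \<and> tau k $ j \<ge> 0) \<and>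
           (\<forall>k l. f (x k) $ l - f x0 $ l
                  + 1 / 2 * ((\<Sum>i\<in>UNIV. mu k $ i * g (x k) $ i)
                             + (\<Sum>j\<in>UNIV. tau k $ j * \<bar>h (x k) $ j\<bar>)) \<le> 0)"
proof -
  note lip = assms(1-3)
  obtain x c \<delta> V where x: "x \<longlonglongrightarrow> x0" and c: "\<And>k::nat. c k > 0" and \<delta>: "\<And>k. \<delta> k > 0"
    and V: "\<And>k. V k \<le> 0"
    and ub: "\<And>k l. f (x k) $ l - f x0 $ l + (c k / 2 * ((\<Sum>i\<in>UNIV. (max (g (x k) $ i) 0)\<^sup>2)
      + (\<Sum>j\<in>UNIV. (h (x k) $ j)\<^sup>2)) + (norm (x k - x0))\<^sup>2 / 2) \<le> V k"
    and lb: "\<And>k u. u \<in> cball (x k) (\<delta> k) \<Longrightarrow> \<exists>l. V k \<le> f u $ l - f x0 $ l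
      + (c k / 2 * ((\<Sum>i\<in>UNIV. (max (g u $ i) 0)\<^sup>2) + (\<Sum>j\<in>UNIV. (h u $ j)\<^sup>2)) + (norm (u - x0))\<^sup>2 / 2)"
    using penalty_minimizers[OF lip[THEN locally_lipschitz_continuous_on] assms(4)]
    by blast
  \<comment> \<open>The one penalty parameter \<open>c k\<close> serves both as \<open>b k\<close>
    and as \<open>c k\<close>.\<close>
  define mu :: "nat \<Rightarrow> real ^ 'm" where "mu = (\<lambda>k. \<chi> i. c k * max (g (x k) $ i) 0)"
  define tau :: "nat \<Rightarrow> real ^ 'r" where "tau = (\<lambda>k. \<chi> j. c k * \<bar>h (x k) $ j\<bar>)"
  have "\<exists>lam :: real ^ 'p. (\<forall>l. 0 \<le> lam $ l) \<and> (\<Sum>l\<in>UNIV. lam $ l) = 1 \<and>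
      stationarity_measure f g h (x k) lam (mu k) (tau k) \<le> ereal (norm (x k - x0))" for k
    unfolding mu_def tau_def
    using stationarity_measure_at_penalty_minimizer[OF lip c \<delta> ub lb, of k] by metis
  then obtain lam :: "nat \<Rightarrow> real ^ 'p" where lam: "\<And>k l. 0 \<le> lam k $ l" "\<And>k. (\<Sum>l\<in>UNIV. lam k $ l) = 1"
    "\<And>k. stationarity_measure f g h (x k) (lam k) (mu k) (tau k) \<le> ereal (norm (x k - x0))"
    by metis
  have mu0: "mu k $ i \<ge> 0" for k i
    using c[of k] by (simp add: mu_def)
  have tau0: "tau k $ j \<ge> 0" for k j
    using c[of k] by (simp add: tau_def)
  have "(\<lambda>k. norm (x k - x0)) \<longlonglongrightarrow> 0"
    using x by (simp add: LIM_zero tendsto_norm_zero)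
  then have "(\<lambda>k. ereal (norm (x k - x0))) \<longlonglongrightarrow> 0"
    by (simp add: zero_ereal_def)
  \<comment> \<open>Squeezed between \<open>0\<close> and the distance of \<open>x k\<close> to
    \<open>x0\<close>.\<close>
  then have stat: "(\<lambda>k. stationarity_measure f g h (x k) (lam k) (mu k) (tau k)) \<longlonglongrightarrow> 0"
    by (rule tendsto_sandwich[OF _ _ tendsto_const, rotated 2])
       (simp_all add: lam(3) stationarity_measure_nonneg)
  have inactive: "\<forall>\<^sub>F k in sequentially. mu k $ i = 0" if "g x0 $ i < 0" for i
  proof -
    have "(\<lambda>k. g (x k) $ i) \<longlonglongrightarrow> g x0 $ i"
      by (rule isCont_tendsto_compose[OF locally_lipschitz_isCont[OF lip(2)] x])
    from order_tendstoD(2)[OF this that] show ?thesis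
      by eventually_elim (simp add: mu_def)
  qed
  have "x0 \<in> feasible_set g h"
    using assms(4) by (simp add: local_weak_efficient_def)
  then have akkt: "AKKT f g h x0 x lam mu tau"
    unfolding AKKT_def using lam(1,2) mu0 x stat inactive by blast
  \<comment> \<open>Half of the multiplier sums is exactly the penalty term at \<open>x k\<close>,
    so the inequality follows from \<open>ub\<close> by discarding the proximal term.\<close>
  have E2: "f (x k) $ l - f x0 $ l + 1 / 2 * ((\<Sum>i\<in>UNIV. mu k $ i * g (x k) $ i)
      + (\<Sum>j\<in>UNIV. tau k $ j * \<bar>h (x k) $ j\<bar>)) \<le> 0" for k l
  proof -
    have "mu k $ i * g (x k) $ i = c k * (max (g (x k) $ i) 0)\<^sup>2" for i
      by (simp add: mu_def max_def power2_eq_square)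
    moreover have "tau k $ j * \<bar>h (x k) $ j\<bar> = c k * (h (x k) $ j)\<^sup>2" for j
      by (simp add: tau_def power2_eq_square)
    ultimately have "1 / 2 * ((\<Sum>i\<in>UNIV. mu k $ i * g (x k) $ i) + (\<Sum>j\<in>UNIV. tau k $ j * \<bar>h (x k) $ j\<bar>))
        = c k / 2 * ((\<Sum>i\<in>UNIV. (max (g (x k) $ i) 0)\<^sup>2) + (\<Sum>j\<in>UNIV. (h (x k) $ j)\<^sup>2))"
      by (simp add: sum_distrib_left[symmetric] distrib_left)
    then show ?thesis
      using ub[of k l] V[of k] zero_le_power2[of "norm (x k - x0)"] by linarith
  qed
  show ?thesis
    by (intro exI[of _ x] exI[of _ lam] exI[of _ mu] exI[of _ tau] exI[of _ c] conjI allI akkt mu0 tau0 E2 c)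
       (simp_all add: mu_def tau_def)
qed

end
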